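(* (The Substitution Principle.) Suppose that a tuple of identities $$\boldsymbol{I}\bigl((x,\vec{x}^{\,\pm1}),[a],[p_1(x,\vec{x}^{\,\pm1})],\dots,[p_k(x,\vec{x}^{\,\pm1})]\bigr)\equiv0$$ holds on the noncommutative jet space $J^\infty(\pi_{\mathrm{NC}})$ for every $k$-tuple of noncommutative variational (co)vectors $p_1,\dots,p_k$ whose coefficients $p_{i,\alpha}(x,\vec{x}^{\,\pm1})$ depend only on points $x\in M^n$ and on letters from the edge alphabet $\vec{x}^{\,\pm1}$. Then the identities in total derivatives $$\boldsymbol{I}\bigl((x,\vec{x}^{\,\pm1}),[a],[p_1(x,\vec{x}^{\,\pm1},[a])],\dots,[p_k(x,\vec{x}^{\,\pm1},[a])]\bigr)\equiv0,$$ viewed as identities with respect to the $p_i$, are valid on $J^\infty(\pi_{\mathrm{NC}})$ for all (co)vectors $p_i$ depending not only on $x$ and $\vec{x}^{\,\pm1}$ but also admitting arbitrary, finite differential order dependence on the jet letters $a_\sigma$, $|\sigma|<\infty$.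
   Context: The ground field is $\mathbb{R}$. $M^n$ is an oriented affine real manifold with local affine coordinates $x=(x^1,\dots,x^n)$. The edge alphabet $\vec{x}^{\,\pm1}=\langle\vec{x}_1^{\,\pm1},\dots,\vec{x}_N^{\,\pm1}\rangle$ consists of noncommuting symbols $\vec{x}_j^{\,+1},\vec{x}_j^{\,-1}$ (elementary steps, in the two directions, between adjacent cells of a fixed regular tiling of $M^n$); the algebra of walks is the unital extension of the free associative algebra on these symbols, with multiplication $\circ$ (concatenation), placed as a sheaf over $M^n$ (so that coefficients are in $C^\infty(M^n)$). The bundle $\pi_{\mathrm{NC}}$ over this has as fibre the (cyclic quotient of the) unital free associative algebra on letters $a^1,\dots,a^m$; a section is an evaluation $a^i=s^i(x,\vec{x}^{\,\pm1})$, a formal sum of words in the edge alphabet with coefficients in $C^\infty(M^n)$. The infinite jet letters are $a^i_\sigma$, with $\sigma$ a multi-index, evaluated on a section as $\partial^{|\sigma|}s^i/\partial x^\sigma$; $[\,\cdot\,]$ denotes dependence on an object and on its derivatives up to a finite order. The total derivative $D_{x^k}$ is the derivation equal to $\partial/\partial x^k$ on coefficients, with $a^i_\sigma\mapsto a^i_{\sigma\cup\{k\}}$ and vanishing on edge letters; it is characterised by $(D_{x^k}f)|_{\mathrm{jet}(s)}=\partial/\partial x^k(f|_{\mathrm{jet}(s)})$. A noncommutative variational covector is $p_i=\bigl(p_{i,\alpha}\circ\delta a^\alpha\bigr)$, i.e. a cyclic word with one marked symbol $\delta a^\alpha$ ($1\le\alpha\le m$, summation over $\alpha$) at which it is opened,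 so that it amounts to its collection of components $p_{i,\alpha}$, each an open word (formal sum of words) in the letters allowed, with coefficients smooth in $x$; a variational vector is described in the same way with $\partial/\partial a$ as marked symbols. The identities $\boldsymbol{I}$ are expressions built by the word multiplication from the letters $\vec{x}^{\,\pm1}$, $a_\sigma$ and the components $p_{i,\alpha}$ and their total derivatives $D^\tau p_{i,\alpha}$, with coefficients smooth in $x$; the open strings $p_{i,\alpha}$ are always inserted into $\boldsymbol{I}$ without being split. *)

theory Defs
  imports "HOL-Analysis.Analysis" "HOL-Library.Multiset"
begin

section \<open>Oriented affine manifolds and smooth functions\<close>

type_synonym ('x, 'n) chart = "'x set \<times> ('x \<Rightarrow> real ^ 'n)"

abbreviation chart_dom :: "('x, 'n) chart \<Rightarrow> 'x set" where
  "chart_dom c \<equiv> fst c"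

abbreviation coords :: "('x, 'n) chart \<Rightarrow> 'x \<Rightarrow> real ^ 'n" where
  "coords c \<equiv> snd c"

definition oriented_affine_manifold ::
    "'x topology \<Rightarrow> ('x, 'n::finite) chart set \<Rightarrow> bool" where
  "oriented_affine_manifold M A \<longleftrightarrow>
     Hausdorff_space M \<and> second_countable M \<and>
     topspace M = (\<Union>c\<in>A. chart_dom c) \<and>
     (\<forall>c\<in>A. openin M (chart_dom c) \<and> open (coords c ` chart_dom c) \<and>
        homeomorphic_map (subtopology M (chart_dom c))
          (top_of_set (coords c ` chart_dom c)) (coords c)) \<and>
     (\<forall>c\<in>A. \<forall>c'\<in>A. \<forall>x \<in> chart_dom c \<inter> chart_dom c'.
        \<exists>W B b. openin M W \<and> x \<in> W \<and> W \<subseteq> chart_dom c \<inter> chart_dom c' \<and> det B > 0 \<and>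
          (\<forall>y\<in>W. coords c' y = B *v coords c y + b))"

text \<open>A function on the manifold is read in a chart through the inverse of the coordinate map.\<close>

definition in_coords :: "('x, 'n) chart \<Rightarrow> ('x \<Rightarrow> real) \<Rightarrow> real ^ 'n \<Rightarrow> real" where
  "in_coords c f = f \<circ> inv_into (chart_dom c) (coords c)"

definition partial_deriv :: "'n \<Rightarrow> (real ^ 'n::finite \<Rightarrow> real) \<Rightarrow> real ^ 'n \<Rightarrow> real" where
  "partial_deriv k g y = frechet_derivative g (at y) (axis k 1)"

primrec Ck_on :: "nat \<Rightarrow> (real ^ 'n::finite) set \<Rightarrow> (real ^ 'n \<Rightarrow> real) \<Rightarrow> bool" where
  "Ck_on 0 S g \<longleftrightarrow> continuous_on S g"
| "Ck_on (Suc r) S g \<longleftrightarrow>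
     (\<forall>y\<in>S. g differentiable (at y)) \<and> (\<forall>k. Ck_on r S (partial_deriv k g))"

text \<open>\<open>W\<close> is meant to be open in the manifold; values outside \<open>W\<close> are irrelevant.\<close>

definition smooth_on ::
    "('x, 'n::finite) chart set \<Rightarrow> 'x set \<Rightarrow> ('x \<Rightarrow> real) \<Rightarrow> bool" where
  "smooth_on A W f \<longleftrightarrow>
     (\<forall>c\<in>A. \<forall>r. Ck_on r (coords c ` (chart_dom c \<inter> W)) (in_coords c f))"

definition coord_deriv :: "('x, 'n::finite) chart \<Rightarrow> 'n \<Rightarrow> ('x \<Rightarrow> real) \<Rightarrow> 'x \<Rightarrow> real" where
  "coord_deriv c k f x = partial_deriv k (in_coords c f) (coords c x)"


section \<open>Sums of words with function coefficients\<close>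

text \<open>
  An element of the unital free associative algebra on letters of type \<open>'l\<close>, with coefficients
  in functions on the manifold, is the family of coefficients of its words; the empty word
  is the unit. Only the values on the subset under consideration matter.
\<close>

type_synonym ('l, 'x) wsum = "'l list \<Rightarrow> 'x \<Rightarrow> real"

definition smooth_wsum ::
    "('x, 'n::finite) chart set \<Rightarrow> 'x set \<Rightarrow> ('l, 'x) wsum \<Rightarrow> bool" where
  "smooth_wsum A W f \<longleftrightarrow>
     finite {w. \<exists>x\<in>W. f w x \<noteq> 0} \<and> (\<forall>w. smooth_on A W (f w))"

definition single_word :: "'l list \<Rightarrow> ('l, 'x) wsum" where
  "single_word w = (\<lambda>v x. if v = w then 1 else 0)"

definition wmult :: "('l, 'x) wsum \<Rightarrow> ('l, 'x) wsum \<Rightarrow> ('l, 'x) wsum" where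
  "wmult f g = (\<lambda>w x. \<Sum>i\<le>length w. f (take i w) x * g (drop i w) x)"

text \<open>
  Vanishing over \<open>U\<close>: as a sum of open words, or, if \<open>cyc\<close>, as a sum of cyclic words,
  i.e. in the quotient where words that differ by a rotation are identified.
\<close>

definition vanishes_on :: "bool \<Rightarrow> 'x set \<Rightarrow> ('l, 'x) wsum \<Rightarrow> bool" where
  "vanishes_on cyc U f \<longleftrightarrow>
     (\<forall>x\<in>U. \<forall>w. if cyc then (\<Sum>v \<in> (\<lambda>r. rotate r w) ` {..length w}. f v x) = 0
                 else f w x = 0)"


section \<open>Jet letters, total derivatives, covectors\<close>

text \<open>
  Edge letters in the two directions, without cancellation, and the jet letters
  \<open>Jet i \<sigma>\<close> with a symmetric multi-index \<open>\<sigma>\<close>; adjoining \<open>k\<close> to \<open>\<sigma>\<close> is \<open>add_mset k \<sigma>\<close>.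
\<close>

datatype ('e, 'm, 'n) jet_letter = Fwd 'e | Bwd 'e | Jet 'm "'n multiset"

definition edge_letters :: "('e, 'm, 'n) jet_letter set" where
  "edge_letters = range Fwd \<union> range Bwd"

definition edge_only :: "'x set \<Rightarrow> (('e, 'm, 'n) jet_letter, 'x) wsum \<Rightarrow> bool" where
  "edge_only W f \<longleftrightarrow> (\<forall>w. (\<exists>x\<in>W. f w x \<noteq> 0) \<longrightarrow> set w \<subseteq> edge_letters)"

text \<open>
  The coefficient of \<open>w\<close> in the total derivative: besides differentiating the coefficient
  of \<open>w\<close> itself, \<open>w\<close> arises from every word in which one of the jet letters of \<open>w\<close>
  has its multi-index lowered by \<open>k\<close>.
\<close>

definition total_deriv :: "('x, 'n::finite) chart \<Rightarrow> 'n \<Rightarrow>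
    (('e, 'm, 'n) jet_letter, 'x) wsum \<Rightarrow> (('e, 'm, 'n) jet_letter, 'x) wsum" where
  "total_deriv c k f = (\<lambda>w x.
     coord_deriv c k (f w) x +
     (\<Sum>(i, a, \<sigma>) \<in> {(i, a, \<sigma>). i < length w \<and> w ! i = Jet a (add_mset k \<sigma>)}.
        f (w[i := Jet a \<sigma>]) x))"

text \<open>
  Total derivatives commute on smooth coefficients, so the choice of the order in which
  the directions in \<open>\<tau>\<close> are listed is immaterial.
\<close>

definition total_deriv_multi :: "('x, 'n::finite) chart \<Rightarrow> 'n multiset \<Rightarrow>
    (('e, 'm, 'n) jet_letter, 'x) wsum \<Rightarrow> (('e, 'm, 'n) jet_letter, 'x) wsum" where
  "total_deriv_multi c \<tau> = foldr (total_deriv c) (SOME ks. mset ks = \<tau>)"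

text \<open>
  A tuple of variational (co)vectors, by its components: \<open>p i \<alpha>\<close> is the open word sum that
  accompanies the marked symbol number \<open>\<alpha>\<close> of the \<open>i\<close>-th (co)vector.
\<close>

type_synonym ('e, 'm, 'n, 'k, 'x) covectors =
  "'k \<Rightarrow> 'm \<Rightarrow> (('e, 'm, 'n) jet_letter, 'x) wsum"


section \<open>Identities in total derivatives\<close>

text \<open>\<open>Cov i \<alpha> \<tau>\<close> is the placeholder for the \<open>\<tau>\<close>-th total derivative of the component \<open>p i \<alpha>\<close>.\<close>

datatype ('e, 'm, 'n, 'k) id_letter =
  Plain "('e, 'm, 'n) jet_letter" | Cov 'k 'm "'n multiset"

primrec insert_letter :: "('x, 'n::finite) chart \<Rightarrow> ('e, 'm, 'n, 'k, 'x) covectors \<Rightarrow>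
    ('e, 'm, 'n, 'k) id_letter \<Rightarrow> (('e, 'm, 'n) jet_letter, 'x) wsum" where
  "insert_letter c p (Plain l) = single_word [l]"
| "insert_letter c p (Cov i \<alpha> \<tau>) = total_deriv_multi c \<tau> (p i \<alpha>)"

definition insert_word :: "('x, 'n::finite) chart \<Rightarrow> ('e, 'm, 'n, 'k, 'x) covectors \<Rightarrow>
    ('e, 'm, 'n, 'k) id_letter list \<Rightarrow> (('e, 'm, 'n) jet_letter, 'x) wsum" where
  "insert_word c p u = foldr wmult (map (insert_letter c p) u) (single_word [])"

definition insert_covectors :: "('x, 'n::finite) chart \<Rightarrow> ('e, 'm, 'n, 'k, 'x) covectors \<Rightarrow>
    (('e, 'm, 'n, 'k) id_letter, 'x) wsum \<Rightarrow> (('e, 'm, 'n) jet_letter, 'x) wsum" where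
  "insert_covectors c p I = (\<lambda>w x. \<Sum>u | I u x \<noteq> 0. I u x * insert_word c p u w x)"

end

theory Submission
  imports Defs
begin

text \<open>
  The hypothesis concerns covectors whose components are sums of edge words only. It is nevertheless
  strong enough to force every identity to be formally trivial: over each point the coefficients of
  the placeholder words in \<open>I\<close> vanish or, for cyclic sums, cancel within each rotation class.

  The reason is that two edge letters already generate a free algebra large enough to encode all
  placeholders. At a fixed point \<open>x\<^sub>0\<close> only finitely many words occur in \<open>I\<close>, of length at most \<open>L\<close>.
  Replace each placeholder that occurs by its own edge word \<open>y x\<^sup>b y\<close> with a huge exponent
  \<open>b > 2 * L\<close>. The long runs of \<open>x\<close> mark the places of insertion unambiguously, even for words read
  cyclically, so distinct placeholder words, or rotation classes of them, stay distinct
  (\<open>encode_inj\<close>, \<open>encode_mem_rotations_iff\<close>).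

  A placeholder stands for a total derivative of a component, and derivatives of different orders
  of the same component have to be replaced by unrelated words. This is possible because the jet of
  a smooth function at a point is arbitrary to any finite order: giving the edge words Taylor
  monomials around \<open>x\<^sub>0\<close> as coefficients, cut off so as to be smooth on the whole manifold, realises
  the replacement at \<open>x\<^sub>0\<close> by admissible covectors (\<open>smooth_bump_monomial\<close>,
  \<open>total_deriv_coding_covectors\<close>). Hence \<open>I\<close> is formally trivial at \<open>x\<^sub>0\<close>
  (\<open>identity_vanishes_formally\<close>).

  A formally trivial identity holds for all insertions. For cyclic words this uses that the factors
  of a product may be rotated in the cyclic quotient (\<open>formally_zero_identity_holds\<close>).
\<close>

section \<open>Calculus of functions of class \<open>C\<^sup>r\<close>\<close>

lemma partial_deriv_eq:
  "(g has_derivative D) (at y) \<Longrightarrow> partial_deriv k g y = D (axis k 1)"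
  unfolding partial_deriv_def by (metis frechet_derivative_at)

text \<open>
  Differentiability and partial derivatives at a point depend on the germ only. All of the
  locality arguments below, in particular the passage between charts, rest on this.
\<close>

lemma partial_deriv_cong:
  assumes "open V" "y \<in> V" "\<And>z. z \<in> V \<Longrightarrow> f z = g z"
  shows "partial_deriv k f y = partial_deriv k g y"
proof -
  have "(f has_derivative D) (at y) \<longleftrightarrow> (g has_derivative D) (at y)" for D
    using assms has_derivative_transform_within_open[of f D y UNIV V g]
      has_derivative_transform_within_open[of g D y UNIV V f] by auto
  then show ?thesis
    unfolding partial_deriv_def frechet_derivative_def by simp
qed

lemma Ck_on_cong:
  assumes "open S" "\<And>y. y \<in> S \<Longrightarrow> f y = g y" "Ck_on r S f"
  shows "Ck_on r S g"
  using assms(2,3)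
proof (induction r arbitrary: f g)
  case 0
  then show ?case by (simp cong: continuous_on_cong)
next
  case (Suc r)
  have "g differentiable (at y)" if "y \<in> S" for y
  proof -
    have "f differentiable (at y)"
      using Suc.prems(2) that by simp
    then obtain D where "(f has_derivative D) (at y)"
      unfolding differentiable_def by blast
    then show ?thesis
      using has_derivative_transform_within_open[OF _ assms(1) that, of f D UNIV g] Suc.prems(1)
      unfolding differentiable_def by auto
  qed
  moreover have "Ck_on r S (partial_deriv k g)" for k
  proof (rule Suc.IH)
    show "partial_deriv k f y = partial_deriv k g y" if "y \<in> S" for y
      by (rule partial_deriv_cong[OF assms(1) that Suc.prems(1)])
    show "Ck_on r S (partial_deriv k f)"
      using Suc.prems(2) by simp
  qed
  ultimately show ?case by simp
qed

text \<open>
  The shape in which \<open>C\<^sup>r\<close> regularity is proved by induction on \<open>r\<close>: the rules of differentiation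
  supply \<open>D\<close>, and its components are built from functions that are already known to be \<open>C\<^sup>r\<close>.
\<close>

lemma Ck_on_SucI:
  assumes "open S" "\<And>y. y \<in> S \<Longrightarrow> (g has_derivative D y) (at y)"
    and "\<And>k. Ck_on r S (\<lambda>y. D y (axis k 1))"
  shows "Ck_on (Suc r) S g"
proof -
  have "g differentiable (at y)" if "y \<in> S" for y
    unfolding differentiable_def using assms(2)[OF that] by blast
  moreover have "Ck_on r S (partial_deriv k g)" for k
    by (rule Ck_on_cong[OF assms(1) _ assms(3)]) (simp add: partial_deriv_eq[OF assms(2)])
  ultimately show ?thesis by simp
qed

lemma Ck_on_SucD:
  assumes "Ck_on (Suc r) S g"
  shows "\<And>y. y \<in> S \<Longrightarrow> (g has_derivative frechet_derivative g (at y)) (at y)"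
    and "\<And>k. Ck_on r S (\<lambda>y. frechet_derivative g (at y) (axis k 1))"
  using assms by (auto simp: frechet_derivative_works partial_deriv_def[abs_def])

lemma Ck_on_Suc_imp: "Ck_on (Suc r) S g \<Longrightarrow> Ck_on r S g"
proof (induction r arbitrary: g)
  case 0
  then show ?case
    by (auto intro!: continuous_at_imp_continuous_on differentiable_imp_continuous_within)
next
  case (Suc r)
  then show ?case
    unfolding Ck_on.simps(2)[of "Suc r"] Ck_on.simps(2)[of r] by blast
qed

lemma Ck_on_local:
  assumes "\<And>y. y \<in> S \<Longrightarrow> \<exists>V. open V \<and> y \<in> V \<and> Ck_on r V g"
  shows "Ck_on r S g"
  using assms
proof (induction r arbitrary: g)
  case 0
  have "isCont g y" if "y \<in> S" for y
    using 0[OF that] continuous_on_eq_continuous_at by auto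
  then show ?case
    by (simp add: continuous_at_imp_continuous_on)
next
  case (Suc r)
  have "g differentiable (at y)" if "y \<in> S" for y
    using Suc.prems[OF that] by auto
  moreover have "Ck_on r S (partial_deriv k g)" for k
  proof (rule Suc.IH)
    show "\<exists>V. open V \<and> y \<in> V \<and> Ck_on r V (partial_deriv k g)" if "y \<in> S" for y
      using Suc.prems[OF that] unfolding Ck_on.simps by blast
  qed
  ultimately show ?case by simp
qed

lemma Ck_on_const: "Ck_on r S (\<lambda>y. a)"
proof (induction r arbitrary: a)
  case (Suc r)
  have "partial_deriv k (\<lambda>y. a) = (\<lambda>y. 0)" for k :: 'a
    by (intro ext partial_deriv_eq) (rule has_derivative_const)
  then show ?case using Suc by simp
qed simp

lemma Ck_on_add:
  assumes "open S" "Ck_on r S f" "Ck_on r S g"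
  shows "Ck_on r S (\<lambda>y. f y + g y)"
  using assms(2,3)
proof (induction r arbitrary: f g)
  case (Suc r)
  show ?case
    by (rule Ck_on_SucI[OF assms(1) has_derivative_add[OF Suc.prems[THEN Ck_on_SucD(1)]]])
      (auto intro: Suc.IH Suc.prems[THEN Ck_on_SucD(2)])
qed (auto intro: continuous_intros)

lemma Ck_on_mult:
  assumes "open S" "Ck_on r S f" "Ck_on r S g"
  shows "Ck_on r S (\<lambda>y. f y * g y)"
  using assms(2,3)
proof (induction r arbitrary: f g)
  case (Suc r)
  show ?case
    by (rule Ck_on_SucI[OF assms(1) has_derivative_mult[OF Suc.prems[THEN Ck_on_SucD(1)]]])
      (auto intro!: Suc.IH Ck_on_add assms(1) Suc.prems[THEN Ck_on_SucD(2)]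
        Suc.prems[THEN Ck_on_Suc_imp])
qed (auto intro: continuous_intros)

lemma Ck_on_diff:
  assumes "open S" "Ck_on r S f" "Ck_on r S g"
  shows "Ck_on r S (\<lambda>y. f y - g y)"
  using Ck_on_add[OF assms(1,2) Ck_on_mult[OF assms(1) Ck_on_const[of _ _ "-1"] assms(3)]] by simp

lemma Ck_on_sum:
  assumes "open S" "\<And>i. i \<in> J \<Longrightarrow> Ck_on r S (f i)"
  shows "Ck_on r S (\<lambda>y. \<Sum>i\<in>J. f i y)"
  using assms(2)
  by (induction J rule: infinite_finite_induct) (auto intro: Ck_on_const Ck_on_add[OF assms(1)])

lemma Ck_on_prod:
  assumes "open S" "\<And>i. i \<in> J \<Longrightarrow> Ck_on r S (f i)"
  shows "Ck_on r S (\<lambda>y. \<Prod>i\<in>J. f i y)"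
  using assms(2)
  by (induction J rule: infinite_finite_induct) (auto intro: Ck_on_const Ck_on_mult[OF assms(1)])

lemma Ck_on_power:
  assumes "open S" "Ck_on r S f"
  shows "Ck_on r S (\<lambda>y. f y ^ m)"
  by (induction m) (auto intro: Ck_on_const Ck_on_mult[OF assms(1)] assms(2))

lemma Ck_on_inverse:
  assumes "open S" "Ck_on r S g" "\<And>y. y \<in> S \<Longrightarrow> g y \<noteq> 0"
  shows "Ck_on r S (\<lambda>y. inverse (g y))"
  using assms(2)
proof (induction r)
  case (Suc r)
  have "((\<lambda>y. inverse (g y)) has_derivative
      (\<lambda>v. - 1 * (inverse (g y) * frechet_derivative g (at y) v * inverse (g y)))) (at y)"
    if "y \<in> S" for y
    using Deriv.has_derivative_inverse[OF assms(3)[OF that] Ck_on_SucD(1)[OF Suc.prems that]] by simp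
  then show ?case
    by (intro Ck_on_SucI[OF assms(1)], assumption)
      (intro Ck_on_mult[OF assms(1)] Ck_on_const Suc.IH
        Ck_on_SucD(2)[OF Suc.prems] Ck_on_Suc_imp[OF Suc.prems])
qed (use assms(3) in \<open>auto intro!: continuous_intros\<close>)

text \<open>
  Transition functions of the atlas are affine, so this is all that is needed about changes of
  coordinates: a function built up from coordinates is \<open>C\<^sup>r\<close> after an affine substitution by the
  same closure rules, without a chain rule in several variables.
\<close>

lemma Ck_on_affine_component:
  assumes "open S"
  shows "Ck_on r S (\<lambda>z. (B *v z + b) $ i)"
proof -
  have "Ck_on r S (\<lambda>z. z $ j)" for j :: 'a
  proof (cases r)
    case (Suc q)
    have "((\<lambda>z. z $ j) has_derivative (\<lambda>v. v $ j)) (at z)" for z :: "real ^ 'a"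
      by (rule bounded_linear_imp_has_derivative) (rule bounded_linear_vec_nth)
    then show ?thesis
      unfolding Suc by (rule Ck_on_SucI[OF assms]) (rule Ck_on_const)
  qed (auto intro: continuous_intros)
  then show ?thesis
    unfolding matrix_vector_mult_def
    by (auto intro!: Ck_on_sum Ck_on_mult Ck_on_add Ck_on_const assms)
qed

text \<open>
  For \<open>m = 0\<close> this is the standard smooth function that is flat at the origin. The factors
  \<open>t\<^sup>-\<^sup>m\<close> make the family closed under differentiation, up to linear combinations, so that all
  of its members can be shown to be smooth by one simultaneous induction.
\<close>

definition flat :: "nat \<Rightarrow> real \<Rightarrow> real" where
  "flat m t = (if t > 0 then inverse t ^ m * exp (- inverse t) else 0)"

lemma flat_tendsto_0: "(flat m \<longlongrightarrow> 0) (at_right 0)"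
proof -
  have "((\<lambda>s. s ^ m / exp s) \<longlongrightarrow> (0::real)) at_top"
    by (rule tendsto_power_div_exp_0)
  then have "((\<lambda>t. inverse t ^ m / exp (inverse t)) \<longlongrightarrow> (0::real)) (at_right 0)"
    by (rule filterlim_compose) (rule filterlim_inverse_at_top_right)
  then show ?thesis
    by (rule Lim_transform_eventually, intro eventually_mono[OF eventually_at_right_less])
      (simp add: flat_def exp_minus divide_inverse)
qed

text \<open>
  Away from the origin this is calculus. At the origin the difference quotient \<open>flat m h / h\<close> is
  \<open>flat (m + 1) h\<close> for \<open>h > 0\<close> and zero for \<open>h < 0\<close>, hence tends to zero, because the
  exponential beats every power.
\<close>

lemma DERIV_flat: "(flat m has_real_derivative flat (m + 2) t - real m * flat (m + 1) t) (at t)"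
proof (cases t "0::real" rule: linorder_cases)
  case less
  have "((\<lambda>t. 0) has_real_derivative 0) (at t)" by simp
  then have "(flat m has_real_derivative 0) (at t)"
    by (rule has_field_derivative_transform_within_open[where S="{..<0}"])
      (use less in \<open>auto simp: flat_def\<close>)
  then show ?thesis using less by (simp add: flat_def)
next
  case greater
  have "((\<lambda>t. inverse t ^ m * exp (- inverse t)) has_real_derivative
      flat (m + 2) t - real m * flat (m + 1) t) (at t)"
  proof -
    have D: "((\<lambda>t. inverse t) has_real_derivative - (inverse t ^ 2)) (at t)"
      using DERIV_inverse[of t UNIV] greater by (simp add: numeral_2_eq_2)
    show ?thesis
      by (rule DERIV_cong[OF DERIV_mult[OF DERIV_power[OF D] DERIV_fun_exp[OF DERIV_minus[OF D]]]])
        (use greater in \<open>cases m; simp add: flat_def algebra_simps power2_eq_square\<close>)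
  qed
  then show ?thesis
    by (rule has_field_derivative_transform_within_open[where S="{0<..}"])
      (use greater in \<open>auto simp: flat_def\<close>)
next
  case equal
  have "((\<lambda>h. flat m h / h) \<longlongrightarrow> 0) (at 0)"
  proof (rule filterlim_split_at)
    show "((\<lambda>h. flat m h / h) \<longlongrightarrow> 0) (at_left 0)"
    proof (rule tendsto_eventually)
      show "\<forall>\<^sub>F h in at_left 0. flat m h / h = 0"
        unfolding eventually_at_filter by (rule always_eventually) (simp add: flat_def)
    qed
    show "((\<lambda>h. flat m h / h) \<longlongrightarrow> 0) (at_right 0)"
    proof (rule Lim_transform_eventually[OF flat_tendsto_0[of "Suc m"]])
      show "\<forall>\<^sub>F h in at_right 0. flat (Suc m) h = flat m h / h"
        using eventually_at_right_less[of 0]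
        by (rule eventually_mono) (simp add: flat_def divide_inverse)
    qed
  qed
  moreover have "flat q 0 = 0" for q
    by (simp add: flat_def)
  ultimately have "(flat m has_real_derivative flat (m + 2) 0 - real m * flat (m + 1) 0) (at 0)"
    unfolding DERIV_def by simp
  then show ?thesis using equal by simp
qed

lemma Ck_on_flat:
  assumes "open S" "Ck_on r S g"
  shows "Ck_on r S (\<lambda>y. flat m (g y))"
  using assms(2)
proof (induction r arbitrary: m)
  case 0
  have "continuous_on UNIV (flat m)"
    by (meson DERIV_flat DERIV_isCont continuous_at_imp_continuous_on)
  then show ?case
    using 0 by (auto intro: continuous_on_compose2)
next
  case (Suc r)
  have "((\<lambda>y. flat m (g y)) has_derivative (\<lambda>v. frechet_derivative g (at y) v *
      (flat (m + 2) (g y) - real m * flat (m + 1) (g y)))) (at y)" if "y \<in> S" for y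
    by (rule DERIV_compose_FDERIV[OF DERIV_flat Ck_on_SucD(1)[OF Suc.prems that]])
  then show ?case
    by (intro Ck_on_SucI[OF assms(1)], assumption)
      (intro Ck_on_mult[OF assms(1)] Ck_on_diff[OF assms(1)] Ck_on_const Suc.IH
        Ck_on_SucD(2)[OF Suc.prems] Ck_on_Suc_imp[OF Suc.prems])
qed

section \<open>Functions with prescribed jets\<close>

text \<open>
  The Taylor monomial \<open>(y - y\<^sub>0)\<^sup>\<tau> / \<tau>!\<close>; the multiset \<open>\<tau>\<close> lists the directions with their
  multiplicities.
\<close>

definition divided_monomial :: "real ^ 'n \<Rightarrow> 'n::finite multiset \<Rightarrow> real ^ 'n \<Rightarrow> real" where
  "divided_monomial y\<^sub>0 \<tau> y = (\<Prod>k\<in>UNIV. (y $ k - y\<^sub>0 $ k) ^ count \<tau> k / fact (count \<tau> k))"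

text \<open>
  The factorials are chosen to make differentiation simply remove one element from \<open>\<tau>\<close>.
\<close>

lemma partial_deriv_divided_monomial:
  "partial_deriv k (divided_monomial y\<^sub>0 \<tau>) =
    (if k \<in># \<tau> then divided_monomial y\<^sub>0 (\<tau> - {#k#}) else (\<lambda>y. 0))"
proof
  fix y
  define F where "F \<tau>' i = (y $ i - y\<^sub>0 $ i) ^ count \<tau>' i / fact (count \<tau>' i)" for \<tau>' i
  define F' where "F' i v = real (count \<tau> i) * (v $ i) * (y $ i - y\<^sub>0 $ i) ^ (count \<tau> i - 1)
      / fact (count \<tau> i)" for i and v :: "real ^ 'a"
  have comp: "((\<lambda>y. y $ i) has_derivative (\<lambda>v. v $ i)) (at y)" for i
    by (rule bounded_linear_imp_has_derivative) (rule bounded_linear_vec_nth)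
  have "((\<lambda>y. (y $ i - y\<^sub>0 $ i) ^ count \<tau> i / fact (count \<tau> i)) has_derivative F' i) (at y)" for i
    unfolding F'_def
    by (rule derivative_eq_intros comp refl | simp)+
  then have "((\<lambda>y. \<Prod>i\<in>UNIV. (y $ i - y\<^sub>0 $ i) ^ count \<tau> i / fact (count \<tau> i)) has_derivative
      (\<lambda>v. \<Sum>i\<in>UNIV. F' i v * (\<Prod>j\<in>UNIV - {i}. F \<tau> j))) (at y)"
    unfolding F_def by (rule has_derivative_prod)
  then have "partial_deriv k (divided_monomial y\<^sub>0 \<tau>) y =
      (\<Sum>i\<in>UNIV. F' i (axis k 1) * (\<Prod>j\<in>UNIV - {i}. F \<tau> j))"
    unfolding divided_monomial_def[abs_def] by (rule partial_deriv_eq)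
  also have "\<dots> = F' k (axis k 1) * (\<Prod>j\<in>UNIV - {k}. F \<tau> j)"
    by (subst sum.remove[of _ k]) (auto simp: F'_def axis_def intro!: sum.neutral)
  also have "\<dots> = (if k \<in># \<tau> then divided_monomial y\<^sub>0 (\<tau> - {#k#}) y else 0)"
  proof (cases "k \<in># \<tau>")
    case True
    then obtain c where c: "count \<tau> k = Suc c" by (metis count_eq_zero_iff not0_implies_Suc)
    have "F' k (axis k 1) = F (\<tau> - {#k#}) k"
      using fact_Suc[of c, where 'a = real]
      by (simp add: F'_def F_def c axis_def del: fact_Suc of_nat_Suc)
    moreover have "(\<Prod>j\<in>UNIV - {k}. F \<tau> j) = (\<Prod>j\<in>UNIV - {k}. F (\<tau> - {#k#}) j)"
      by (auto simp: F_def intro!: prod.cong)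
    ultimately show ?thesis
      using True prod.remove[of UNIV k "F (\<tau> - {#k#})"]
      by (simp add: divided_monomial_def F_def)
  next
    case False
    then have "F' k = (\<lambda>v. 0)"
      by (intro ext) (simp add: F'_def not_in_iff)
    then show ?thesis using False by simp
  qed
  finally show "partial_deriv k (divided_monomial y\<^sub>0 \<tau>) y =
    (if k \<in># \<tau> then divided_monomial y\<^sub>0 (\<tau> - {#k#}) else (\<lambda>y. 0)) y" by simp
qed

lemma divided_monomial_at_centre: "divided_monomial y\<^sub>0 \<tau> y\<^sub>0 = (if \<tau> = {#} then 1 else 0)"
proof (cases "\<tau> = {#}")
  case False
  then obtain k where "k \<in># \<tau>" by auto
  then show ?thesis using False
    unfolding divided_monomial_def
    by (auto intro!: prod_zero bexI[of _ k] simp: power_0_left)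
qed (simp add: divided_monomial_def)

text \<open>
  Taylor monomials are dual to iterated partial derivatives at the centre. This is what makes the
  values of the several derivatives of one component independent of each other.
\<close>

lemma jet_of_divided_monomial:
  "foldr partial_deriv ks (divided_monomial y\<^sub>0 \<tau>) y\<^sub>0 = (if mset ks = \<tau> then 1 else 0)"
proof -
  have "foldr partial_deriv ks (divided_monomial y\<^sub>0 \<tau>) =
    (if mset ks \<subseteq># \<tau> then divided_monomial y\<^sub>0 (\<tau> - mset ks) else (\<lambda>y. 0))"
  proof (induction ks)
    case (Cons k ks)
    have "partial_deriv k (\<lambda>y. 0) = (\<lambda>y. 0)"
      by (intro ext partial_deriv_eq) (rule has_derivative_const)
    moreover have "add_mset k K \<subseteq># \<tau> \<longleftrightarrow> K \<subseteq># \<tau> \<and> k \<in># \<tau> - K" for K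
    proof -
      have "add_mset k K \<subseteq># \<tau> \<Longrightarrow> K \<subseteq># \<tau>"
        by (rule subset_mset.order_trans[of _ "add_mset k K"]) simp
      moreover have "add_mset k K \<subseteq># K + (\<tau> - K) \<longleftrightarrow> {#k#} \<subseteq># \<tau> - K"
        using mset_subset_eq_mono_add_left_cancel[of K "{#k#}" "\<tau> - K"] by simp
      ultimately show ?thesis
        by (metis single_subset_iff subset_mset.add_diff_inverse)
    qed
    ultimately show ?case
      by (simp add: Cons partial_deriv_divided_monomial)
  qed simp
  then show ?thesis
    by (auto simp: divided_monomial_at_centre Diff_eq_empty_iff_mset intro: subset_mset.antisym)
qed

text \<open>
  A plateau function: \<open>q\<close> is the squared distance from \<open>y\<^sub>0\<close>, and the quotient equals one where the
  second summand of the denominator vanishes and zero where the numerator does. For \<open>\<delta> > 0\<close> these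
  are the ball of radius \<open>\<delta> / 2\<close> and the outside of the ball of radius \<open>\<delta>\<close>.
\<close>

definition cutoff :: "real \<Rightarrow> real ^ 'n::finite \<Rightarrow> real ^ 'n \<Rightarrow> real" where
  "cutoff \<delta> y\<^sub>0 y =
    (let q = \<Sum>k\<in>UNIV. (y $ k - y\<^sub>0 $ k)\<^sup>2
     in flat 0 (\<delta>\<^sup>2 - q) * inverse (flat 0 (\<delta>\<^sup>2 - q) + flat 0 (q - (\<delta> / 2)\<^sup>2)))"

lemma sum_squares_eq_dist: "(\<Sum>k\<in>UNIV. (y $ k - y\<^sub>0 $ k)\<^sup>2) = (dist y y\<^sub>0)\<^sup>2"
  unfolding dist_norm power2_norm_eq_inner inner_vec_def by (simp add: power2_eq_square)

lemma flat_pos_iff: "flat m t > 0 \<longleftrightarrow> t > 0" and flat_nonneg: "flat m t \<ge> 0"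
  and flat_eq_0: "t \<le> 0 \<Longrightarrow> flat m t = 0"
  by (auto simp: flat_def)

lemma cutoff_eq_1: "dist y y\<^sub>0 < \<delta> / 2 \<Longrightarrow> cutoff \<delta> y\<^sub>0 y = 1"
proof -
  assume less: "dist y y\<^sub>0 < \<delta> / 2"
  then have "(dist y y\<^sub>0)\<^sup>2 < \<delta>\<^sup>2" "(dist y y\<^sub>0)\<^sup>2 < (\<delta> / 2)\<^sup>2"
    by (auto intro!: power_strict_mono) (smt (verit) zero_le_dist)
  then show ?thesis
    using flat_pos_iff[of 0 "\<delta>\<^sup>2 - (dist y y\<^sub>0)\<^sup>2"]
    by (simp add: cutoff_def sum_squares_eq_dist flat_eq_0 Let_def)
qed

lemma cutoff_eq_0: "0 < \<delta> \<Longrightarrow> \<delta> \<le> dist y y\<^sub>0 \<Longrightarrow> cutoff \<delta> y\<^sub>0 y = 0"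
  by (simp add: cutoff_def sum_squares_eq_dist flat_eq_0 Let_def power_mono)

text \<open>
  Stated with an inner substitution \<open>L\<close>, so that it applies in every chart, with \<open>L\<close> the
  transition to the chart in which cutoff and monomial are defined.
\<close>

lemma Ck_on_cutoff_monomial:
  assumes "open S" "0 < \<delta>" and L: "\<And>i. Ck_on r S (\<lambda>z. L z $ i)"
  shows "Ck_on r S (\<lambda>z. cutoff \<delta> y\<^sub>0 (L z) * divided_monomial y\<^sub>0 \<tau> (L z))"
proof -
  \<comment> \<open>The inner radius is smaller than the outer one, so one of the two summands is positive.\<close>
  have "flat 0 (\<delta>\<^sup>2 - q) + flat 0 (q - (\<delta> / 2)\<^sup>2) \<noteq> 0" for q
  proof -
    have "(\<delta> / 2)\<^sup>2 < \<delta>\<^sup>2"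
      using \<open>0 < \<delta>\<close> by (intro power_strict_mono) auto
    then have "0 < \<delta>\<^sup>2 - q \<or> 0 < q - (\<delta> / 2)\<^sup>2" by linarith
    then show ?thesis
      using flat_pos_iff[of 0 "\<delta>\<^sup>2 - q"] flat_pos_iff[of 0 "q - (\<delta> / 2)\<^sup>2"]
        flat_nonneg[of 0 "\<delta>\<^sup>2 - q"] flat_nonneg[of 0 "q - (\<delta> / 2)\<^sup>2"] by linarith
  qed
  then have "Ck_on r S (\<lambda>z. cutoff \<delta> y\<^sub>0 (L z))"
    unfolding cutoff_def Let_def
    by (intro Ck_on_mult Ck_on_inverse Ck_on_add Ck_on_flat Ck_on_diff Ck_on_const Ck_on_sum
        Ck_on_power L assms(1)) auto
  moreover have "Ck_on r S (\<lambda>z. divided_monomial y\<^sub>0 \<tau> (L z))"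
    unfolding divided_monomial_def divide_inverse
    by (intro Ck_on_prod Ck_on_mult Ck_on_power Ck_on_diff Ck_on_const L assms(1))
  ultimately show ?thesis by (rule Ck_on_mult[OF assms(1)])
qed

definition bump_monomial ::
    "('x, 'n::finite) chart \<Rightarrow> real \<Rightarrow> real ^ 'n \<Rightarrow> 'n multiset \<Rightarrow> 'x \<Rightarrow> real" where
  "bump_monomial c \<delta> y\<^sub>0 \<tau> x =
    (if x \<in> chart_dom c
     then cutoff \<delta> y\<^sub>0 (coords c x) * divided_monomial y\<^sub>0 \<tau> (coords c x) else 0)"

lemma chart_facts:
  assumes "oriented_affine_manifold M A" "c \<in> A"
  shows "openin M (chart_dom c)" "open (coords c ` chart_dom c)"
    and "homeomorphic_map (subtopology M (chart_dom c))
          (top_of_set (coords c ` chart_dom c)) (coords c)"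
    and "inj_on (coords c) (chart_dom c)"
    and "topspace (subtopology M (chart_dom c)) = chart_dom c"
proof -
  show o: "openin M (chart_dom c)" and "open (coords c ` chart_dom c)"
    and h: "homeomorphic_map (subtopology M (chart_dom c))
          (top_of_set (coords c ` chart_dom c)) (coords c)"
    using assms unfolding oriented_affine_manifold_def by blast+
  show t: "topspace (subtopology M (chart_dom c)) = chart_dom c"
    using openin_subset[OF o] by (simp add: topspace_subtopology inf_absorb2)
  show "inj_on (coords c) (chart_dom c)"
    using homeomorphic_imp_injective_map[OF h] t by simp
qed

lemma open_coords_image:
  assumes "oriented_affine_manifold M A" "c \<in> A" "openin M W" "W \<subseteq> chart_dom c"
  shows "open (coords c ` W)"
proof -
  have "openin (subtopology M (chart_dom c)) W"
    using assms(3,4) by (auto simp: openin_subtopology)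
  then have "openin (top_of_set (coords c ` chart_dom c)) (coords c ` W)"
    using homeomorphic_imp_open_map[OF chart_facts(3)[OF assms(1,2)]] by (simp add: open_map_def)
  then show ?thesis
    using chart_facts(2)[OF assms(1,2)] by (metis openin_open_eq)
qed

lemma in_coords_image:
  assumes "inj_on (coords c) (chart_dom c)" "x \<in> chart_dom c"
  shows "in_coords c f (coords c x) = f x"
  using assms by (simp add: in_coords_def)

text \<open>
  Near a point of the chart \<open>c\<close>, in any other chart, the function is a cut off monomial composed
  with an affine map. The closed ball around \<open>y\<^sub>0\<close> corresponds to a compact set \<open>K\<close> in the domain
  of \<open>c\<close>; as the manifold is Hausdorff, \<open>K\<close> is closed, so every point outside the domain of \<open>c\<close>
  has a neighbourhood that misses \<open>K\<close>, and there the function vanishes.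
\<close>

lemma smooth_bump_monomial:
  assumes manifold: "oriented_affine_manifold M A" and c: "c \<in> A"
    and \<delta>: "0 < \<delta>" "cball y\<^sub>0 \<delta> \<subseteq> coords c ` chart_dom c"
  shows "smooth_on A (topspace M) (bump_monomial c \<delta> y\<^sub>0 \<tau>)"
  unfolding smooth_on_def
proof (intro ballI allI Ck_on_local)
  fix c' r z
  assume c': "c' \<in> A" and "z \<in> coords c' ` (chart_dom c' \<inter> topspace M)"
  then obtain x where x: "x \<in> chart_dom c'" "z = coords c' x" by auto
  let ?f = "bump_monomial c \<delta> y\<^sub>0 \<tau>"
  have read: "in_coords c' ?f (coords c' w) = ?f w" if "w \<in> chart_dom c'" for w
    by (rule in_coords_image[OF chart_facts(4)[OF manifold c'] that])
  show "\<exists>V. open V \<and> z \<in> V \<and> Ck_on r V (in_coords c' ?f)"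
  proof (cases "x \<in> chart_dom c")
    case True
    then have "x \<in> chart_dom c' \<inter> chart_dom c" using x by simp
    then have "\<exists>W B b. openin M W \<and> x \<in> W \<and> W \<subseteq> chart_dom c' \<inter> chart_dom c \<and> det B > 0 \<and>
        (\<forall>w\<in>W. coords c w = B *v coords c' w + b)"
      using manifold c c' unfolding oriented_affine_manifold_def by simp
    then obtain W B b where W: "openin M W" "x \<in> W" "W \<subseteq> chart_dom c' \<inter> chart_dom c"
      and B: "\<And>w. w \<in> W \<Longrightarrow> coords c w = B *v coords c' w + b"
      by blast
    define F where "F z = cutoff \<delta> y\<^sub>0 (B *v z + b) * divided_monomial y\<^sub>0 \<tau> (B *v z + b)" for z
    have V: "open (coords c' ` W)"
      using W by (intro open_coords_image[OF manifold c']) auto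
    have F: "Ck_on r (coords c' ` W) F"
      unfolding F_def
      by (rule Ck_on_cutoff_monomial[OF V \<delta>(1)]) (rule Ck_on_affine_component[OF V])
    have "F z = in_coords c' ?f z" if z: "z \<in> coords c' ` W" for z
    proof -
      obtain w where w: "w \<in> W" "z = coords c' w" using z by auto
      have "w \<in> chart_dom c'" "w \<in> chart_dom c" using W(3) w(1) by auto
      have "F z = ?f w"
        unfolding w(2) F_def B[OF w(1), symmetric]
        using \<open>w \<in> chart_dom c\<close> by (simp add: bump_monomial_def)
      also have "?f w = in_coords c' ?f z"
        unfolding w(2) by (rule read[OF \<open>w \<in> chart_dom c'\<close>, symmetric])
      finally show ?thesis .
    qed
    then have "Ck_on r (coords c' ` W) (in_coords c' ?f)"
      by (rule Ck_on_cong[OF V _ F])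
    then show ?thesis
      using V W(2) x(2) by (intro exI[of _ "coords c' ` W"]) simp
  next
    case False
    obtain g where g: "homeomorphic_maps (subtopology M (chart_dom c))
        (top_of_set (coords c ` chart_dom c)) (coords c) g"
      using chart_facts(3)[OF manifold c] by (auto simp: homeomorphic_map_maps)
    define K where "K = g ` cball y\<^sub>0 \<delta>"
    have "compactin (top_of_set (coords c ` chart_dom c)) (cball y\<^sub>0 \<delta>)"
      using \<delta>(2) by (simp add: compactin_subtopology)
    then have "compactin (subtopology M (chart_dom c)) K"
      unfolding K_def using g by (intro image_compactin) (auto simp: homeomorphic_maps_def)
    then have K: "compactin M K" "K \<subseteq> chart_dom c"
      by (auto simp: compactin_subtopology)
    have "closedin M K"
      using manifold K(1) unfolding oriented_affine_manifold_def
      by (intro compactin_imp_closedin) simp_all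
    then have W: "openin M (chart_dom c' - K)"
      using chart_facts(1)[OF manifold c'] by (rule openin_diff[rotated])
    let ?V = "coords c' ` (chart_dom c' - K)"
    have V: "open ?V"
      by (rule open_coords_image[OF manifold c' W]) auto
    have "?f w = 0" if "w \<notin> K" for w
    proof (cases "w \<in> chart_dom c")
      case True
      then have "g (coords c w) = w"
        using g chart_facts(5)[OF manifold c] by (simp add: homeomorphic_maps_def)
      then have "coords c w \<notin> cball y\<^sub>0 \<delta>"
        using that unfolding K_def by (metis imageI)
      then show ?thesis
        using \<delta>(1) by (simp add: bump_monomial_def cutoff_eq_0 dist_commute)
    qed (simp add: bump_monomial_def)
    then have "0 = in_coords c' ?f z" if "z \<in> ?V" for z
      using that read by auto
    then have "Ck_on r ?V (in_coords c' ?f)"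
      by (rule Ck_on_cong[OF V _ Ck_on_const])
    moreover have "z \<in> ?V" using x K(2) False by auto
    ultimately show ?thesis using V by (intro exI[of _ ?V]) simp
  qed
qed

text \<open>
  Iterated coordinate derivatives of a function may be computed on any expression \<open>F\<close> for it that
  is valid on an open set of coordinate values. Values of \<open>in_coords\<close> outside the image of the
  chart are arbitrary, hence the restriction of \<open>V\<close> to that image.
\<close>

lemma foldr_coord_deriv_local:
  assumes inj: "inj_on (coords c) (chart_dom c)"
    and V: "open V" "V \<subseteq> coords c ` chart_dom c"
    and eq: "\<And>x. x \<in> chart_dom c \<Longrightarrow> coords c x \<in> V \<Longrightarrow> f x = F (coords c x)"
    and "x \<in> chart_dom c" "coords c x \<in> V"
  shows "foldr (coord_deriv c) ks f x = foldr partial_deriv ks F (coords c x)"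
  using assms(5,6)
proof (induction ks arbitrary: x)
  case (Cons k ks)
  have "in_coords c (foldr (coord_deriv c) ks f) z = foldr partial_deriv ks F z" if z: "z \<in> V" for z
  proof -
    obtain w where "w \<in> chart_dom c" "z = coords c w" using z V(2) by auto
    then show ?thesis using Cons.IH[of w] z by (simp add: in_coords_image[OF inj])
  qed
  then have "partial_deriv k (in_coords c (foldr (coord_deriv c) ks f)) (coords c x) =
      partial_deriv k (foldr partial_deriv ks F) (coords c x)"
    by (rule partial_deriv_cong[OF V(1) Cons.prems(2)])
  then show ?case by (simp add: coord_deriv_def[of c k])
qed (simp add: eq)

lemma jet_of_bump_monomial:
  assumes manifold: "oriented_affine_manifold M A" and c: "c \<in> A" and x: "x\<^sub>0 \<in> chart_dom c"
    and \<delta>: "0 < \<delta>" "cball (coords c x\<^sub>0) \<delta> \<subseteq> coords c ` chart_dom c"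
  shows "foldr (coord_deriv c) ks (bump_monomial c \<delta> (coords c x\<^sub>0) \<tau>) x\<^sub>0 =
    (if mset ks = \<tau> then 1 else 0)"
proof -
  let ?V = "ball (coords c x\<^sub>0) (\<delta> / 2)"
  have "?V \<subseteq> cball (coords c x\<^sub>0) \<delta>" using \<delta>(1) by auto
  then have V: "?V \<subseteq> coords c ` chart_dom c" using \<delta>(2) by blast
  have "foldr (coord_deriv c) ks (bump_monomial c \<delta> (coords c x\<^sub>0) \<tau>) x\<^sub>0 =
      foldr partial_deriv ks (divided_monomial (coords c x\<^sub>0) \<tau>) (coords c x\<^sub>0)"
  proof (rule foldr_coord_deriv_local[OF chart_facts(4)[OF manifold c] _ V])
    show "bump_monomial c \<delta> (coords c x\<^sub>0) \<tau> x = divided_monomial (coords c x\<^sub>0) \<tau> (coords c x)"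
      if "x \<in> chart_dom c" "coords c x \<in> ?V" for x
      using that by (simp add: bump_monomial_def cutoff_eq_1 dist_commute)
  qed (use x \<delta>(1) in auto)
  then show ?thesis by (simp add: jet_of_divided_monomial)
qed

section \<open>Cyclic words and the trace property\<close>

definition rotations :: "'l list \<Rightarrow> 'l list set" where
  "rotations w = (\<lambda>r. rotate r w) ` {..length w}"

lemma finite_rotations: "finite (rotations w)"
  by (simp add: rotations_def)

lemma rotate_split: "i \<le> length w \<Longrightarrow> rotate i w = drop i w @ take i w"
  by (metis append_take_drop_id length_take min.absorb2 rotate_append)

lemma mem_rotations_iff: "v \<in> rotations w \<longleftrightarrow> (\<exists>p q. w = p @ q \<and> v = q @ p)"
proof
  assume "v \<in> rotations w"
  then obtain r where "r \<le> length w" "v = rotate r w" by (auto simp: rotations_def)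
  then show "\<exists>p q. w = p @ q \<and> v = q @ p"
    by (intro exI[of _ "take r w"] exI[of _ "drop r w"]) (simp add: rotate_split)
next
  assume "\<exists>p q. w = p @ q \<and> v = q @ p"
  then obtain p q where "w = p @ q" "v = q @ p" by blast
  then have "v = rotate (length p) w" "length p \<le> length w" by (simp_all add: rotate_append)
  then show "v \<in> rotations w" by (auto simp: rotations_def)
qed

lemma append_mem_rotations: "q @ p \<in> rotations (p @ q)"
  by (auto simp: mem_rotations_iff)

lemma rotations_eq_range: "rotations w = range (\<lambda>r. rotate r w)"
proof -
  have "rotate r w \<in> rotations w" for r
  proof (cases "w = []")
    case False
    then have "r mod length w \<le> length w" by (simp add: less_imp_le)
    then show ?thesis
      unfolding rotations_def by (subst rotate_conv_mod) (rule imageI, simp)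
  qed (simp add: rotations_def)
  then show ?thesis by (auto simp: rotations_def)
qed

lemma self_mem_rotations: "w \<in> rotations w"
  by (auto simp: mem_rotations_iff)

lemma rotations_sym: "v \<in> rotations w \<Longrightarrow> w \<in> rotations v"
  by (auto simp: mem_rotations_iff)

lemma rotations_cong: "v \<in> rotations w \<Longrightarrow> rotations v = rotations w"
proof -
  have sub: "rotations v \<subseteq> rotations w" if "v \<in> rotations w" for v w :: "'a list"
    using that by (auto simp: rotations_eq_range rotate_rotate)
  assume v: "v \<in> rotations w"
  show "rotations v = rotations w"
    by (rule equalityI[OF sub[OF v] sub[OF rotations_sym[OF v]]])
qed

lemma length_rotations: "v \<in> rotations w \<Longrightarrow> length v = length w"
  by (auto simp: rotations_def)

text \<open>
  With the one-element class of an open word, open and cyclic sums are treated alike from here on.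
\<close>

lemma vanishes_on_iff:
  "vanishes_on cyc U f \<longleftrightarrow>
    (\<forall>x\<in>U. \<forall>w. (\<Sum>v \<in> (if cyc then rotations w else {w}). f v x) = 0)"
  by (auto simp: vanishes_on_def rotations_def)

lemma wmult_unit_left: "wmult (single_word []) f = f"
proof (intro ext)
  fix w x
  have "wmult (single_word []) f w x = (\<Sum>i\<le>length w. if i = 0 then f w x else 0)"
    unfolding wmult_def single_word_def by (intro sum.cong) auto
  then show "wmult (single_word []) f w x = f w x" by simp
qed

lemma wmult_assoc:
  fixes f g h :: "('l, 'x) wsum"
  shows "wmult (wmult f g) h = wmult f (wmult g h)"
proof (intro ext)
  fix w :: "'l list" and x :: 'x
  let ?n = "length w"
  have "wmult (wmult f g) h w x =
      (\<Sum>(i, j)\<in>(SIGMA i:{..?n}. {..i}).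
        f (take j w) x * g (drop j (take i w)) x * h (drop i w) x)"
    unfolding wmult_def sum_distrib_right
    by (subst sum.Sigma[symmetric]) (auto intro!: sum.cong simp: min_def)
  also have "\<dots> = (\<Sum>(j, k)\<in>(SIGMA j:{..?n}. {..?n - j}).
        f (take j w) x * g (take k (drop j w)) x * h (drop k (drop j w)) x)"
    by (rule sum.reindex_bij_witness[where i="\<lambda>(j, k). (j + k, j)" and j="\<lambda>(i, j). (j, i - j)"])
      (auto simp: drop_take)
  also have "\<dots> = wmult f (wmult g h) w x"
    unfolding wmult_def sum_distrib_left
    by (subst sum.Sigma[symmetric]) (auto intro!: sum.cong)
  finally show "wmult (wmult f g) h w x = wmult f (wmult g h) w x" .
qed

text \<open>
  The quotient by rotations is a trace: \<open>f \<circ> g\<close> and \<open>g \<circ> f\<close> have the same coefficients on cyclic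
  words. A pair of a rotation \<open>v\<close> of \<open>w\<close> and a cut of \<open>v\<close> corresponds to the rotation of \<open>v\<close> at
  this cut together with the complementary cut.
\<close>

lemma cyclic_sum_wmult_commute:
  fixes f g :: "('l, 'x) wsum"
  shows "(\<Sum>v\<in>rotations w. wmult f g v x) = (\<Sum>v\<in>rotations w. wmult g f v x)"
proof -
  let ?n = "length w"
  have expand: "(\<Sum>v\<in>rotations w. wmult f g v x) =
      (\<Sum>(v, i)\<in>rotations w \<times> {..?n}. f (take i v) x * g (drop i v) x)"
    for f g :: "('l, 'x) wsum"
    unfolding wmult_def sum.cartesian_product[symmetric]
    by (intro sum.cong) (auto simp: length_rotations)
  have rot: "rotate i v \<in> rotations w" if "v \<in> rotations w" for i v
    using that by (auto simp: rotations_eq_range rotate_rotate)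
  have rot_back: "rotate (?n - i) (rotate i v) = v" if "v \<in> rotations w" "i \<le> ?n" for i v
    using that length_rotations[OF that(1)] by (simp add: rotate_rotate)
  have split: "take (?n - i) (rotate i v) = drop i v" "drop (?n - i) (rotate i v) = take i v"
    if "v \<in> rotations w" "i \<le> ?n" for i v
    using that by (simp_all add: rotate_split length_rotations)
  show ?thesis
    unfolding expand
    by (rule sum.reindex_bij_witness[where i="\<lambda>(v, i). (rotate i v, ?n - i)"
          and j="\<lambda>(v, i). (rotate i v, ?n - i)"])
      (auto simp: rot rot_back split mult.commute)
qed

lemma insert_word_append:
  "insert_word c p (u @ v) = wmult (insert_word c p u) (insert_word c p v)"
proof (induction u)
  case (Cons a u)
  then show ?case by (simp add: insert_word_def wmult_assoc)
qed (simp add: insert_word_def wmult_unit_left)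

text \<open>
  An identity whose placeholder words cancel formally, up to rotation in the cyclic case, holds for
  whatever is inserted: rotating a placeholder word rotates the product that it denotes, so by the
  trace property the contribution of a word depends on its rotation class only, and the
  coefficients in each class add up to zero.
\<close>

lemma formally_zero_identity_holds:
  fixes I :: "(('e, 'm, 'n::finite, 'k) id_letter, 'x) wsum"
  assumes "\<And>x. x \<in> U \<Longrightarrow> finite {u. I u x \<noteq> 0}" and "vanishes_on cyc U I"
  shows "vanishes_on cyc U (insert_covectors c p I)"
  unfolding vanishes_on_iff
proof (intro ballI allI)
  fix x w assume x: "x \<in> U"
  define R where "R u = (if cyc then rotations u else {u})" for u :: "('e, 'm, 'n, 'k) id_letter list"
  define t where
    "t u = (\<Sum>v\<in>(if cyc then rotations w else {w}). insert_word c p u v x)" for u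
  have R_eq: "R u = R v \<longleftrightarrow> u \<in> R v" for u v
    unfolding R_def using self_mem_rotations[of u] rotations_cong[of u v] by auto
  have t_eq: "t u = t v" if u: "u \<in> R v" for u v
  proof (cases cyc)
    case True
    then obtain a b where "v = a @ b" "u = b @ a" using u by (auto simp: R_def mem_rotations_iff)
    then show ?thesis
      unfolding t_def if_P[OF True] by (simp only: insert_word_append) (rule cyclic_sum_wmult_commute)
  qed (use u in \<open>simp add: R_def\<close>)
  define supp where "supp = {u. I u x \<noteq> 0}"
  \<comment> \<open>The support need not be a union of classes; it is enlarged to one before grouping.\<close>
  define S where "S = (\<Union>u\<in>supp. R u)"
  have fin: "finite supp" "finite S"
    using assms(1)[OF x] by (auto simp: supp_def S_def R_def finite_rotations)
  have "supp \<subseteq> S"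
    unfolding S_def using R_eq by blast
  have "(\<Sum>v\<in>(if cyc then rotations w else {w}). insert_covectors c p I v x) =
      (\<Sum>u\<in>supp. I u x * t u)"
    unfolding insert_covectors_def supp_def[symmetric] t_def sum_distrib_left by (rule sum.swap)
  also have "\<dots> = (\<Sum>u\<in>S. I u x * t u)"
    using fin(2) \<open>supp \<subseteq> S\<close> by (intro sum.mono_neutral_left) (auto simp: supp_def)
  also have "\<dots> = (\<Sum>C\<in>R ` S. \<Sum>u\<in>{u\<in>S. R u = C}. I u x * t u)"
    by (rule sum.group[symmetric]) (use fin in auto)
  also have "\<dots> = 0"
  proof (rule sum.neutral, rule ballI)
    fix C assume "C \<in> R ` S"
    then obtain v where v: "v \<in> S" "C = R v" by blast
    then obtain u\<^sub>0 where "u\<^sub>0 \<in> supp" "v \<in> R u\<^sub>0" unfolding S_def by blast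
    then have "R v \<subseteq> S"
      unfolding S_def using R_eq by blast
    then have "{u\<in>S. R u = C} = R v"
      unfolding v(2) R_eq by blast
    then have "(\<Sum>u\<in>{u\<in>S. R u = C}. I u x * t u) = (\<Sum>u\<in>R v. I u x * t v)"
      by (intro sum.cong) (simp_all add: t_eq[of _ v])
    also have "\<dots> = (\<Sum>u\<in>R v. I u x) * t v"
      by (rule sum_distrib_right[symmetric])
    also have "(\<Sum>u\<in>R v. I u x) = 0"
      using assms(2) x unfolding vanishes_on_iff R_def by blast
    finally show "(\<Sum>u\<in>{u\<in>S. R u = C}. I u x * t u) = 0" by simp
  qed
  finally show "(\<Sum>v\<in>(if cyc then rotations w else {w}). insert_covectors c p I v x) = 0" .
qed

section \<open>A substitution by edge words that can be decoded\<close>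

text \<open>
  With \<open>x\<close> and \<open>y\<close> for the forward and the backward letter of an arbitrarily chosen edge, this is
  \<open>y x\<^sup>b y\<close>. Each placeholder is replaced by such a word, with its own exponent. When the
  exponents exceed the number of letters of the words under consideration, a run of \<open>x\<close> from a
  block cannot be imitated by plain letters, and the final \<open>y\<close> marks where the run ends.
\<close>

definition block :: "nat \<Rightarrow> ('e, 'm, 'n) jet_letter list" where
  "block b = Bwd undefined # replicate b (Fwd undefined) @ [Bwd undefined]"

primrec encode_letter ::
    "('k \<times> 'm \<times> 'n multiset \<Rightarrow> nat) \<Rightarrow> ('e, 'm, 'n, 'k) id_letter \<Rightarrow> ('e, 'm, 'n) jet_letter list" where
  "encode_letter N (Plain l) = [l]"
| "encode_letter N (Cov i \<alpha> \<tau>) = block (N (i, \<alpha>, \<tau>))"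

definition encode ::
    "('k \<times> 'm \<times> 'n multiset \<Rightarrow> nat) \<Rightarrow> ('e, 'm, 'n, 'k) id_letter list \<Rightarrow> ('e, 'm, 'n) jet_letter list" where
  "encode N u = concat (map (encode_letter N) u)"

lemma encode_simps [simp]:
  "encode N [] = []" "encode N (a # u) = encode_letter N a @ encode N u"
  "encode N (u @ v) = encode N u @ encode N v"
  by (simp_all add: encode_def)

definition placeholders :: "('e, 'm, 'n, 'k) id_letter list \<Rightarrow> ('k \<times> 'm \<times> 'n multiset) set" where
  "placeholders u = {(i, \<alpha>, \<tau>). Cov i \<alpha> \<tau> \<in> set u}"

lemma placeholders_simps [simp]:
  "placeholders [] = {}" "placeholders (Plain l # u) = placeholders u"
  "placeholders (Cov i \<alpha> \<tau> # u) = insert (i, \<alpha>, \<tau>) (placeholders u)"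
  "placeholders (u @ v) = placeholders u \<union> placeholders v"
  by (auto simp: placeholders_def)

lemma finite_placeholders: "finite (placeholders u)"
proof (induction u)
  case (Cons a u)
  then show ?case by (cases a) auto
qed simp

text \<open>
  A block begins with \<open>y\<close>, so a run of \<open>x\<close> at the beginning of an encoded word consists of plain
  letters.
\<close>

lemma initial_run_le_length:
  "encode N u = replicate b (Fwd undefined) @ s \<Longrightarrow> b \<le> length u"
proof (induction u arbitrary: b)
  case (Cons a u)
  then show ?case by (cases a; cases b) (auto simp: block_def)
qed simp

text \<open>
  Blocks are palindromes, so facts about beginnings transfer to ends.
\<close>

lemma encode_rev: "encode N (rev u) = rev (encode N u)"
proof (induction u)
  case (Cons a u)
  then show ?case by (cases a) (simp_all add: block_def)
qed simp

lemma final_run_le_length: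
  "encode N u = s @ replicate b (Fwd undefined) \<Longrightarrow> b \<le> length u"
  using initial_run_le_length[of N "rev u" b "rev s"] by (simp add: encode_rev)

lemma block_prefix_cancel:
  "block a @ s = block b @ s' \<Longrightarrow> a = b \<and> s = s'"
proof (induction a arbitrary: b)
  case 0
  then show ?case by (cases b) (auto simp: block_def)
next
  case (Suc a)
  then obtain b' where "b = Suc b'" by (cases b) (auto simp: block_def)
  then show ?case using Suc by (auto simp: block_def)
qed

lemma block_inj: "block a = block b \<longleftrightarrow> a = b"
  using block_prefix_cancel[of a "[]" b "[]"] by auto

text \<open>
  Words are decoded from the left. The only possible confusion is between a plain letter \<open>y\<close> and
  the beginning of a block; then the word with the plain letter would have to continue with more
  plain letters \<open>x\<close> than it has letters.
\<close>

lemma encode_inj: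
  assumes "inj_on N T" "\<And>t. t \<in> T \<Longrightarrow> L < N t"
    and "placeholders u \<subseteq> T" "placeholders v \<subseteq> T" "length u \<le> L" "length v \<le> L"
    and "encode N u = encode N v"
  shows "u = v"
  using assms(3-)
proof (induction u arbitrary: v)
  case Nil
  then show ?case
  proof (cases v)
    case (Cons b v')
    then show ?thesis using Nil by (cases b) (auto simp: block_def)
  qed simp
next
  case (Cons a u)
  then obtain b v' where v: "v = b # v'"
    by (cases v; cases a) (auto simp: block_def)
  have clash: False if "encode N (Plain l # u1) = encode N (Cov i \<alpha> \<tau> # u2)"
    "(i, \<alpha>, \<tau>) \<in> T" "length u1 < L" for l i \<alpha> \<tau> u1 u2
    using that assms(2)[OF that(2)] initial_run_le_length[of N u1 "N (i, \<alpha>, \<tau>)"]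
    by (auto simp: block_def)
  show ?case
  proof (cases a)
    case a: (Plain l)
    show ?thesis
    proof (cases b)
      case (Plain l')
      then show ?thesis using Cons a v by auto
    next
      case (Cov i \<alpha> \<tau>)
      then show ?thesis using Cons.prems a v clash[of l u i \<alpha> \<tau> v'] by auto
    qed
  next
    case a: (Cov i \<alpha> \<tau>)
    show ?thesis
    proof (cases b)
      case (Plain l')
      then show ?thesis using Cons.prems a v clash[of l' v' i \<alpha> \<tau> u] by auto
    next
      case (Cov i' \<alpha>' \<tau>')
      then have "N (i, \<alpha>, \<tau>) = N (i', \<alpha>', \<tau>')" "encode N u = encode N v'"
        using Cons.prems a v by (auto dest: block_prefix_cancel)
      then show ?thesis
        using Cons a v Cov assms(1) by (auto dest: inj_onD)
    qed
  qed
qed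

text \<open>
  A cut of an encoded word falls between the codes of two letters or inside a block.
\<close>

lemma cut_encoded_word:
  assumes "encode N u = p @ q"
  shows "(\<exists>u1 u2. u = u1 @ u2 \<and> p = encode N u1 \<and> q = encode N u2) \<or>
    (\<exists>u1 i \<alpha> \<tau> u2 p' q'. u = u1 @ Cov i \<alpha> \<tau> # u2 \<and> p = encode N u1 @ p' \<and> q = q' @ encode N u2 \<and>
      p' @ q' = block (N (i, \<alpha>, \<tau>)) \<and> p' \<noteq> [] \<and> q' \<noteq> [])" (is "?whole u p \<or> ?cut u p")
  using assms
proof (induction u arbitrary: p)
  case (Cons a u)
  show ?case
  proof (cases "p = []")
    case True
    then show ?thesis
      using Cons.prems by (intro disjI1 exI[of _ "[]"] exI[of _ "a # u"]) simp
  next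
    case False
    from Cons.prems have "encode_letter N a @ encode N u = p @ q" by simp
    then consider (past) s where "p = encode_letter N a @ s" "encode N u = s @ q"
      | (inside) s where "encode_letter N a = p @ s" "q = s @ encode N u"
      by (auto simp: append_eq_append_conv2)
    then show ?thesis
    proof cases
      case past
      from Cons.IH[OF past(2)] show ?thesis
      proof
        assume "?whole u s"
        then obtain u1 u2 where "u = u1 @ u2" "s = encode N u1" "q = encode N u2" by blast
        then show ?thesis
          using past(1) by (intro disjI1 exI[of _ "a # u1"] exI[of _ u2]) simp
      next
        assume "?cut u s"
        then obtain u1 i \<alpha> \<tau> u2 p' q' where "u = u1 @ Cov i \<alpha> \<tau> # u2" "s = encode N u1 @ p'"
          "q = q' @ encode N u2" "p' @ q' = block (N (i, \<alpha>, \<tau>))" "p' \<noteq> []" "q' \<noteq> []"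
          by blast
        then show ?thesis
          using past(1)
          by (intro disjI2 exI[of _ "a # u1"] exI[of _ i] exI[of _ \<alpha>] exI[of _ \<tau>] exI[of _ u2]
              exI[of _ p'] exI[of _ q']) simp
      qed
    next
      case inside
      show ?thesis
      proof (cases "s = []")
        case True
        then show ?thesis
          using inside by (intro disjI1 exI[of _ "[a]"] exI[of _ u]) simp
      next
        case s: False
        have "length p \<noteq> 0" "length s \<noteq> 0" using False s by auto
        then have "length (encode_letter N a) \<noteq> 1"
          using inside(1) by (metis One_nat_def add_is_1 length_append)
        then obtain i \<alpha> \<tau> where "a = Cov i \<alpha> \<tau>" by (cases a) auto
        then show ?thesis
          using inside False s
          by (intro disjI2 exI[of _ "[]"] exI[of _ i] exI[of _ \<alpha>] exI[of _ \<tau>] exI[of _ u]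
              exI[of _ p] exI[of _ s]) simp
      qed
    qed
  qed
qed simp

lemma proper_cut_of_block:
  assumes "p @ q = block b" "p \<noteq> []" "q \<noteq> []"
  obtains j k where "p = Bwd undefined # replicate j (Fwd undefined)"
    "q = replicate k (Fwd undefined) @ [Bwd undefined]" "j + k = b"
proof -
  obtain p' where p: "p = Bwd undefined # p'" "p' @ q = replicate b (Fwd undefined) @ [Bwd undefined]"
    using assms by (cases p) (auto simp: block_def)
  obtain q' where q: "q = q' @ [Bwd undefined]" "p' @ q' = replicate b (Fwd undefined)"
    using p(2) assms(3) by (cases q rule: rev_cases) auto
  have "p' = replicate (length p') (Fwd undefined)" "q' = replicate (length q') (Fwd undefined)"
    using q(2) by (metis append_eq_conv_conj take_replicate length_replicate length_append
        drop_replicate diff_add_inverse min.absorb1 le_add1)+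
  moreover have "length p' + length q' = b"
    using arg_cong[OF q(2), of length] by simp
  ultimately show ?thesis using that p(1) q(1) by metis
qed

text \<open>
  A rotation of an encoded word that is an encoded word again cannot cut a block: it would begin
  with \<open>x\<^sup>k\<close> and end with \<open>x\<^sup>j\<close>, where \<open>j + k\<close> is the exponent of that block. Such runs consist of
  plain letters, so both \<open>j\<close> and \<open>k\<close> are at most \<open>L\<close>, while the exponent exceeds \<open>2 * L\<close>. A rotation
  between letters comes from a rotation of the placeholder word.
\<close>

lemma encode_mem_rotations_iff:
  assumes inj: "inj_on N T" and long: "\<And>t. t \<in> T \<Longrightarrow> 2 * L < N t"
    and u: "placeholders u \<subseteq> T" "length u \<le> L" and v: "placeholders v \<subseteq> T" "length v \<le> L"
  shows "encode N v \<in> rotations (encode N u) \<longleftrightarrow> v \<in> rotations u"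
proof
  assume "encode N v \<in> rotations (encode N u)"
  then obtain p q where pq: "encode N u = p @ q" "encode N v = q @ p"
    unfolding mem_rotations_iff by blast
  from cut_encoded_word[OF pq(1)] show "v \<in> rotations u"
  proof (elim disjE exE conjE)
    fix u1 u2 assume w: "u = u1 @ u2" "p = encode N u1" "q = encode N u2"
    have "L < N t" if "t \<in> T" for t using long[OF that] by simp
    then have "v = u2 @ u1"
      by (rule encode_inj[OF inj]) (use u v w pq in auto)
    then show ?thesis using w(1) by (auto simp: mem_rotations_iff)
  next
    fix u1 i \<alpha> \<tau> u2 p' q'
    assume w: "u = u1 @ Cov i \<alpha> \<tau> # u2" "p = encode N u1 @ p'" "q = q' @ encode N u2"
      and cut: "p' @ q' = block (N (i, \<alpha>, \<tau>))" "p' \<noteq> []" "q' \<noteq> []"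
    obtain j k where jk: "p' = Bwd undefined # replicate j (Fwd undefined)"
      "q' = replicate k (Fwd undefined) @ [Bwd undefined]" "j + k = N (i, \<alpha>, \<tau>)"
      by (rule proper_cut_of_block[OF cut])
    have "encode N v = (q @ encode N u1 @ [Bwd undefined]) @ replicate j (Fwd undefined)"
      using pq(2) w jk by simp
    then have "j \<le> length v" by (rule final_run_le_length)
    moreover have "encode N v = replicate k (Fwd undefined) @ [Bwd undefined] @ encode N u2 @ p"
      using pq(2) w jk by simp
    then have "k \<le> length v" by (rule initial_run_le_length)
    moreover have "2 * L < j + k"
      using long[of "(i, \<alpha>, \<tau>)"] u(1) w(1) jk(3) by simp
    ultimately show ?thesis using v(2) by simp
  qed
next
  assume "v \<in> rotations u"
  then obtain a b where "u = a @ b" "v = b @ a" by (auto simp: mem_rotations_iff)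
  then show "encode N v \<in> rotations (encode N u)" by (simp add: append_mem_rotations)
qed

lemma wmult_of_words_at:
  assumes "\<And>w. f w x = (if w = a then 1 else 0)" "\<And>w. g w x = (if w = b then 1 else 0)"
  shows "wmult f g w x = (if w = a @ b then 1 else 0)"
proof -
  have "wmult f g w x =
      (\<Sum>i\<le>length w. if i = length a then (if w = a @ b then 1 else 0) else 0)"
    unfolding wmult_def assms
  proof (intro sum.cong refl)
    fix i assume "i \<in> {..length w}"
    then have i: "length (take i w) = i" by simp
    have "take i w = a \<and> drop i w = b \<longleftrightarrow> i = length a \<and> w = a @ b"
      using i append_take_drop_id[of i w] append_eq_conv_conj by metis
    moreover have "(if take i w = a then 1 else 0) * (if drop i w = b then 1 else 0) =
        (if take i w = a \<and> drop i w = b then 1 else (0::real))"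
      by simp
    ultimately show "(if take i w = a then 1 else 0) * (if drop i w = b then 1 else 0) =
        (if i = length a then if w = a @ b then 1 else 0 else (0::real))"
      by simp
  qed
  then show ?thesis by (simp add: sum.delta)
qed

lemma insert_word_at:
  assumes "\<And>l w. l \<in> set u \<Longrightarrow> insert_letter c p l w x = (if w = encode_letter N l then 1 else 0)"
  shows "insert_word c p u w x = (if w = encode N u then 1 else 0)"
  using assms
proof (induction u arbitrary: w)
  case Nil
  show ?case by (simp add: insert_word_def single_word_def)
next
  case (Cons a u)
  have "insert_word c p (a # u) = wmult (insert_letter c p a) (insert_word c p u)"
    by (simp add: insert_word_def)
  moreover have "wmult (insert_letter c p a) (insert_word c p u) w x =
      (if w = encode_letter N a @ encode N u then 1 else 0)"
  proof (rule wmult_of_words_at)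
    show "insert_letter c p a v x = (if v = encode_letter N a then 1 else 0)" for v
      by (rule Cons.prems) simp
    show "insert_word c p u v x = (if v = encode N u then 1 else 0)" for v
      by (rule Cons.IH) (simp add: Cons.prems)
  qed
  ultimately show ?case by (simp only: encode_simps)
qed

section \<open>Edge covectors that realise the substitution\<close>

lemma coord_deriv_zero: "coord_deriv c k (\<lambda>x. 0) = (\<lambda>x. 0)"
proof -
  have "in_coords c (\<lambda>x. 0) = (\<lambda>y. 0)" by (simp add: in_coords_def fun_eq_iff)
  moreover have "partial_deriv k (\<lambda>y. 0) y = 0" for y
    by (rule partial_deriv_eq) (rule has_derivative_const)
  ultimately show ?thesis by (simp only: coord_deriv_def[abs_def])
qed

text \<open>
  On sums of edge words the total derivative acts on coefficients only: lowering the index of a jet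
  letter of \<open>w\<close> leads to a word that still contains a jet letter and hence has coefficient zero.
\<close>

lemma foldr_total_deriv_edge_words:
  assumes "\<And>w. \<not> set w \<subseteq> edge_letters \<Longrightarrow> f w = (\<lambda>x. 0)"
  shows "foldr (total_deriv c) ks f = (\<lambda>w. foldr (coord_deriv c) ks (f w))"
proof (induction ks)
  case (Cons k ks)
  let ?g = "\<lambda>w. foldr (coord_deriv c) ks (f w)"
  have zero: "?g w = (\<lambda>x. 0)" if "\<not> set w \<subseteq> edge_letters" for w
    by (induction ks) (simp_all add: assms[OF that] coord_deriv_zero)
  have "?g (w[i := Jet a \<sigma>]) x = 0" if "i < length w" for w i a \<sigma> x
  proof -
    have "Jet a \<sigma> \<in> set (w[i := Jet a \<sigma>])" using that by (rule set_update_memI)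
    moreover have "Jet a \<sigma> \<notin> edge_letters" by (auto simp: edge_letters_def)
    ultimately show ?thesis using zero by (metis subsetD)
  qed
  then have "total_deriv c k ?g w x = coord_deriv c k (?g w) x" for w x
    unfolding total_deriv_def by (auto intro!: sum.neutral)
  then show ?case by (simp add: Cons fun_eq_iff)
qed simp

text \<open>
  The component \<open>p i \<alpha>\<close> is the sum over \<open>\<tau>\<close> of the block for \<open>(i, \<alpha>, \<tau>)\<close>, with the cut off Taylor
  monomial of index \<open>\<tau>\<close> as its coefficient. It is written as a family of coefficients, where the
  sum has at most one term when \<open>N\<close> gives distinct placeholders in \<open>T\<close> distinct exponents.
\<close>

definition coding_covectors :: "('x, 'n::finite) chart \<Rightarrow> real \<Rightarrow> real ^ 'n \<Rightarrow>
    ('k \<times> 'm \<times> 'n multiset \<Rightarrow> nat) \<Rightarrow> ('k \<times> 'm \<times> 'n multiset) set \<Rightarrow>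
    ('e, 'm, 'n, 'k, 'x) covectors" where
  "coding_covectors c \<delta> y\<^sub>0 N T i \<alpha> w x =
    (\<Sum>\<tau> | (i, \<alpha>, \<tau>) \<in> T \<and> w = block (N (i, \<alpha>, \<tau>)). bump_monomial c \<delta> y\<^sub>0 \<tau> x)"

lemma coding_covectors_cases [consumes 1, case_names code other]:
  assumes "inj_on N T"
  obtains \<tau> where "(i, \<alpha>, \<tau>) \<in> T" "w = block (N (i, \<alpha>, \<tau>))"
      "coding_covectors c \<delta> y\<^sub>0 N T i \<alpha> w = bump_monomial c \<delta> y\<^sub>0 \<tau>"
  | "\<And>\<tau>. (i, \<alpha>, \<tau>) \<in> T \<Longrightarrow> w \<noteq> block (N (i, \<alpha>, \<tau>))"
      "coding_covectors c \<delta> y\<^sub>0 N T i \<alpha> w = (\<lambda>x. 0)"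
proof (cases "\<exists>\<tau>. (i, \<alpha>, \<tau>) \<in> T \<and> w = block (N (i, \<alpha>, \<tau>))")
  case True
  then obtain \<tau> where \<tau>: "(i, \<alpha>, \<tau>) \<in> T" "w = block (N (i, \<alpha>, \<tau>))" by blast
  then have "{\<sigma>. (i, \<alpha>, \<sigma>) \<in> T \<and> w = block (N (i, \<alpha>, \<sigma>))} = {\<tau>}"
    using assms by (auto simp: block_inj dest: inj_onD)
  then have "coding_covectors c \<delta> y\<^sub>0 N T i \<alpha> w = bump_monomial c \<delta> y\<^sub>0 \<tau>"
    unfolding coding_covectors_def by (simp add: fun_eq_iff)
  then show ?thesis by (rule that(1)[OF \<tau>])
next
  case False
  then have "{\<sigma>. (i, \<alpha>, \<sigma>) \<in> T \<and> w = block (N (i, \<alpha>, \<sigma>))} = {}" by blast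
  then have "coding_covectors c \<delta> y\<^sub>0 N T i \<alpha> w = (\<lambda>x. 0)"
    unfolding coding_covectors_def by (simp only: sum.empty)
  then show ?thesis using False that(2) by blast
qed

lemma block_edge_letters: "set (block b) \<subseteq> edge_letters"
  by (auto simp: block_def edge_letters_def)

lemma coding_covectors_admissible:
  fixes A :: "('x, 'n::finite) chart set" and N :: "'k \<times> 'm \<times> 'n multiset \<Rightarrow> nat"
  assumes manifold: "oriented_affine_manifold M A" and c: "c \<in> A"
    and \<delta>: "0 < \<delta>" "cball y\<^sub>0 \<delta> \<subseteq> coords c ` chart_dom c"
    and N: "inj_on N T" and T: "finite T"
  shows "smooth_wsum A (topspace M)
      (coding_covectors c \<delta> y\<^sub>0 N T i \<alpha> :: (('e, 'm, 'n) jet_letter, 'x) wsum)"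
    and "edge_only (topspace M)
      (coding_covectors c \<delta> y\<^sub>0 N T i \<alpha> :: (('e, 'm, 'n) jet_letter, 'x) wsum)"
proof -
  let ?p = "coding_covectors c \<delta> y\<^sub>0 N T i \<alpha> :: (('e, 'm, 'n) jet_letter, 'x) wsum"
  have "?p w = (\<lambda>x. 0)" if "w \<notin> (\<lambda>t. block (N t)) ` T" for w
    by (cases rule: coding_covectors_cases[OF N, where i=i and \<alpha>=\<alpha> and w=w and c=c
        and \<delta>=\<delta> and y\<^sub>0=y\<^sub>0]) (use that in auto)
  then have "{w. \<exists>x\<in>topspace M. ?p w x \<noteq> 0} \<subseteq> (\<lambda>t. block (N t)) ` T" by force
  then have "finite {w. \<exists>x\<in>topspace M. ?p w x \<noteq> 0}"
    by (rule finite_subset[OF _ finite_imageI[OF T]])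
  moreover have "smooth_on A (topspace M) (?p w)" for w
    using N
  proof (cases rule: coding_covectors_cases[where i=i and \<alpha>=\<alpha> and w=w and c=c
        and \<delta>=\<delta> and y\<^sub>0=y\<^sub>0])
    case (code \<tau>)
    show ?thesis
      unfolding code(3) by (rule smooth_bump_monomial[OF manifold c \<delta>])
  next
    case other
    have "in_coords c' (\<lambda>x. 0) = (\<lambda>y. 0)" for c' :: "('x, 'n) chart"
      by (simp add: in_coords_def fun_eq_iff)
    then show ?thesis
      unfolding other(2) smooth_on_def by (simp add: Ck_on_const)
  qed
  ultimately show "smooth_wsum A (topspace M) ?p" by (simp add: smooth_wsum_def)
  show "edge_only (topspace M) ?p"
    unfolding edge_only_def
  proof (intro allI impI)
    fix w assume nz: "\<exists>x\<in>topspace M. ?p w x \<noteq> 0"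
    show "set w \<subseteq> edge_letters"
      using N
    proof (cases rule: coding_covectors_cases[where i=i and \<alpha>=\<alpha> and w=w and c=c
        and \<delta>=\<delta> and y\<^sub>0=y\<^sub>0])
      case (code \<tau>)
      then show ?thesis using block_edge_letters by simp
    next
      case other
      then show ?thesis using nz by simp
    qed
  qed
qed

text \<open>
  By duality, applying the derivative of index \<open>\<tau>\<close> at \<open>x\<^sub>0\<close> leaves exactly the block for
  \<open>(i, \<alpha>, \<tau>)\<close>, with coefficient one.
\<close>

lemma total_deriv_coding_covectors:
  assumes manifold: "oriented_affine_manifold M A" and c: "c \<in> A" and x: "x\<^sub>0 \<in> chart_dom c"
    and \<delta>: "0 < \<delta>" "cball (coords c x\<^sub>0) \<delta> \<subseteq> coords c ` chart_dom c"
    and N: "inj_on N T" and t: "(i, \<alpha>, \<tau>) \<in> T"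
  shows "total_deriv_multi c \<tau> (coding_covectors c \<delta> (coords c x\<^sub>0) N T i \<alpha>) w x\<^sub>0 =
    (if w = block (N (i, \<alpha>, \<tau>)) then 1 else 0)"
proof -
  let ?p = "coding_covectors c \<delta> (coords c x\<^sub>0) N T i \<alpha>"
  define ks where "ks = (SOME ks. mset ks = \<tau>)"
  have ks: "mset ks = \<tau>"
    unfolding ks_def by (rule someI_ex) (rule ex_mset)
  have zero: "?p v = (\<lambda>x. 0)" if "\<not> set v \<subseteq> edge_letters" for v
    by (cases rule: coding_covectors_cases[OF N, where i=i and \<alpha>=\<alpha> and w=v and c=c
        and \<delta>=\<delta> and y\<^sub>0="coords c x\<^sub>0"])
      (use that block_edge_letters in auto)
  have "total_deriv_multi c \<tau> ?p w x\<^sub>0 = foldr (coord_deriv c) ks (?p w) x\<^sub>0"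
    unfolding total_deriv_multi_def ks_def[symmetric]
    by (rule fun_cong[OF fun_cong[OF foldr_total_deriv_edge_words[OF zero]]])
  also have "\<dots> = (if w = block (N (i, \<alpha>, \<tau>)) then 1 else 0)"
    using N
  proof (cases rule: coding_covectors_cases[where i=i and \<alpha>=\<alpha> and w=w and c=c
        and \<delta>=\<delta> and y\<^sub>0="coords c x\<^sub>0"])
    case (code \<sigma>)
    have "w = block (N (i, \<alpha>, \<tau>)) \<longleftrightarrow> \<tau> = \<sigma>"
      using code(1,2) t N by (auto simp: block_inj dest: inj_onD)
    then show ?thesis
      unfolding code(3) jet_of_bump_monomial[OF manifold c x \<delta>] ks by simp
  next
    case other
    have "foldr (coord_deriv c) ks (\<lambda>x. 0) = (\<lambda>x. 0)"
      by (induction ks) (simp_all add: coord_deriv_zero)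
    then show ?thesis using other t by simp
  qed
  finally show ?thesis .
qed

section \<open>The substitution principle\<close>

text \<open>
  If \<open>I\<close> is annihilated at \<open>x\<^sub>0\<close> by all covectors over edge words, it is so by the coding covectors.
  Inserting these turns the placeholder word \<open>u\<close> into the single word \<open>encode N u\<close>, and the
  coefficient of the result at that word, or at its rotation class, is the corresponding sum of
  coefficients of \<open>I\<close>, since the encoding merges no two classes in the support of \<open>I\<close>.
\<close>

lemma identity_vanishes_formally:
  fixes I :: "(('e, 'm, 'n::finite, 'k) id_letter, 'x) wsum"
  assumes manifold: "oriented_affine_manifold M A" and c: "c \<in> A" and x: "x\<^sub>0 \<in> chart_dom c"
    and finite_support: "finite {u. I u x\<^sub>0 \<noteq> 0}"
    and hyp: "\<And>p :: ('e, 'm, 'n, 'k, 'x) covectors.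
        (\<And>i \<alpha>. smooth_wsum A (topspace M) (p i \<alpha>) \<and> edge_only (topspace M) (p i \<alpha>)) \<Longrightarrow>
        vanishes_on cyc {x\<^sub>0} (insert_covectors c p I)"
  shows "vanishes_on cyc {x\<^sub>0} I"
proof -
  let ?R = "\<lambda>w. if cyc then rotations w else {w}"
  define supp where "supp = {u. I u x\<^sub>0 \<noteq> 0}"
  have fin: "finite supp" using finite_support by (simp add: supp_def)
  \<comment> \<open>Any common bound for the lengths of the words in the support will do.\<close>
  define L where "L = (\<Sum>u\<in>supp. length u)"
  have len: "length u \<le> L" if "u \<in> supp" for u
    unfolding L_def using fin that by (simp add: member_le_sum)
  define T where "T = (\<Union>u\<in>supp. placeholders u)"
  have "finite T" using fin by (simp add: T_def finite_placeholders)
  have T: "placeholders u \<subseteq> T" if "u \<in> supp" for u using that by (auto simp: T_def)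
  obtain f :: "'k \<times> 'm \<times> 'n multiset \<Rightarrow> nat" where f: "inj_on f T"
    using finite_imp_inj_to_nat_seg[OF \<open>finite T\<close>] by blast
  \<comment> \<open>Injectivity tells placeholders apart; the offset makes the blocks impossible to cut or imitate.\<close>
  define N where "N t = f t + Suc (2 * L)" for t
  have N: "inj_on N T" "\<And>t. 2 * L < N t"
    using f by (auto simp: N_def inj_on_def)
  have "coords c x\<^sub>0 \<in> coords c ` chart_dom c" using x by simp
  then obtain \<delta> where \<delta>: "0 < \<delta>" "cball (coords c x\<^sub>0) \<delta> \<subseteq> coords c ` chart_dom c"
    using chart_facts(2)[OF manifold c] by (meson open_contains_cball)
  define p :: "('e, 'm, 'n, 'k, 'x) covectors"
    where "p = coding_covectors c \<delta> (coords c x\<^sub>0) N T"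
  have word: "insert_word c p u w x\<^sub>0 = (if w = encode N u then 1 else 0)" if u: "u \<in> supp" for u w
  proof (rule insert_word_at)
    fix l v assume l: "l \<in> set u"
    show "insert_letter c p l v x\<^sub>0 = (if v = encode_letter N l then 1 else 0)"
    proof (cases l)
      case (Cov i \<alpha> \<tau>)
      then have "(i, \<alpha>, \<tau>) \<in> T" using l T[OF u] by (auto simp: placeholders_def)
      then show ?thesis
        unfolding Cov p_def
        by (simp add: total_deriv_coding_covectors[OF manifold c x \<delta> N(1)])
    qed (simp add: single_word_def)
  qed
  have "vanishes_on cyc {x\<^sub>0} (insert_covectors c p I)"
    unfolding p_def
    by (intro hyp conjI coding_covectors_admissible[OF manifold c \<delta> N(1) \<open>finite T\<close>])
  then have zero: "(\<Sum>v\<in>?R w. insert_covectors c p I v x\<^sub>0) = 0" for w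
    unfolding vanishes_on_iff by blast
  have code: "encode N v \<in> ?R (encode N u) \<longleftrightarrow> v \<in> ?R u" if "u \<in> supp" "v \<in> supp" for u v
  proof (cases cyc)
    case True
    then show ?thesis
      using encode_mem_rotations_iff[OF N T[OF that(1)] len[OF that(1)] T[OF that(2)] len[OF that(2)]]
      by simp
  next
    case False
    have "L < N t" for t using N(2)[of t] by simp
    then have "encode N v = encode N u \<Longrightarrow> v = u"
      using encode_inj[OF N(1) _ T[OF that(2)] T[OF that(1)] len[OF that(2)] len[OF that(1)]] by blast
    then show ?thesis using False by auto
  qed
  have supp_zero: "(\<Sum>v\<in>?R u. I v x\<^sub>0) = 0" if u: "u \<in> supp" for u
  proof -
    have "0 = (\<Sum>w\<in>?R (encode N u). \<Sum>v\<in>supp. I v x\<^sub>0 * insert_word c p v w x\<^sub>0)"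
      using zero[of "encode N u"] by (simp add: insert_covectors_def supp_def)
    also have "\<dots> = (\<Sum>v\<in>supp. \<Sum>w\<in>?R (encode N u). I v x\<^sub>0 * insert_word c p v w x\<^sub>0)"
      by (rule sum.swap)
    also have "\<dots> = (\<Sum>v\<in>supp. if v \<in> ?R u then I v x\<^sub>0 else 0)"
    proof (intro sum.cong refl)
      fix v assume v: "v \<in> supp"
      have "(\<Sum>w\<in>?R (encode N u). I v x\<^sub>0 * insert_word c p v w x\<^sub>0) =
          (\<Sum>w\<in>?R (encode N u). if w = encode N v then I v x\<^sub>0 else 0)"
        by (intro sum.cong refl) (simp add: word[OF v])
      also have "\<dots> = (if encode N v \<in> ?R (encode N u) then I v x\<^sub>0 else 0)"
        by (rule sum.delta) (simp add: finite_rotations)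
      also have "\<dots> = (if v \<in> ?R u then I v x\<^sub>0 else 0)"
        by (simp only: code[OF u v])
      finally show "(\<Sum>w\<in>?R (encode N u). I v x\<^sub>0 * insert_word c p v w x\<^sub>0) =
          (if v \<in> ?R u then I v x\<^sub>0 else 0)" .
    qed
    also have "\<dots> = (\<Sum>v\<in>supp \<inter> ?R u. I v x\<^sub>0)"
      by (rule sum.inter_restrict[OF fin, symmetric])
    also have "\<dots> = (\<Sum>v\<in>?R u. I v x\<^sub>0)"
      by (rule sum.mono_neutral_left) (auto simp: supp_def finite_rotations)
    finally show ?thesis by simp
  qed
  have "(\<Sum>v\<in>?R u. I v x\<^sub>0) = 0" for u
  proof (cases "?R u \<inter> supp = {}")
    case True
    then show ?thesis by (intro sum.neutral) (auto simp: supp_def)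
  next
    case False
    then obtain v where "v \<in> ?R u" "v \<in> supp" by blast
    moreover from this have "?R v = ?R u" using rotations_cong[of v u] by (cases cyc) simp_all
    ultimately show ?thesis using supp_zero[of v] by simp
  qed
  then show ?thesis by (simp add: vanishes_on_iff)
qed

theorem theorem17:
  fixes M :: "'x topology"
    and A :: "('x, 'n::finite) chart set"
    and I :: "('x, 'n) chart \<Rightarrow> 'j::finite \<Rightarrow>
                (('e::finite, 'm::finite, 'n, 'k::finite) id_letter, 'x) wsum"
    and cyc :: "'j \<Rightarrow> bool"
  assumes manifold: "oriented_affine_manifold M A"
    and identities: "\<And>c j. c \<in> A \<Longrightarrow> smooth_wsum A (chart_dom c) (I c j)"
    and hyp: "\<And>p :: ('e, 'm, 'n, 'k, 'x) covectors.
        (\<And>i \<alpha>. smooth_wsum A (topspace M) (p i \<alpha>) \<and> edge_only (topspace M) (p i \<alpha>)) \<Longrightarrow>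
        (\<And>c j. c \<in> A \<Longrightarrow>
           vanishes_on (cyc j) (chart_dom c) (insert_covectors c p (I c j)))"
  shows "\<forall>c\<in>A. \<forall>p :: ('e, 'm, 'n, 'k, 'x) covectors.
        (\<forall>i \<alpha>. smooth_wsum A (chart_dom c) (p i \<alpha>)) \<longrightarrow>
        (\<forall>j. vanishes_on (cyc j) (chart_dom c) (insert_covectors c p (I c j)))"
proof (intro ballI allI impI)
  fix c j and p :: "('e, 'm, 'n, 'k, 'x) covectors"
  assume c: "c \<in> A"
  have finite_support: "finite {u. I c j u x \<noteq> 0}" if "x \<in> chart_dom c" for x
    using identities[OF c, of j] that unfolding smooth_wsum_def
    by (elim conjE) (erule rev_finite_subset, blast)
  have "vanishes_on (cyc j) {x} (I c j)" if x: "x \<in> chart_dom c" for x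
  proof (rule identity_vanishes_formally[OF manifold c x, where I = "I c j", OF finite_support[OF x]])
    fix q :: "('e, 'm, 'n, 'k, 'x) covectors"
    assume "\<And>i \<alpha>. smooth_wsum A (topspace M) (q i \<alpha>) \<and> edge_only (topspace M) (q i \<alpha>)"
    from hyp[OF this c, of j] show "vanishes_on (cyc j) {x} (insert_covectors c q (I c j))"
      using x by (simp add: vanishes_on_def)
  qed
  then have zero: "vanishes_on (cyc j) (chart_dom c) (I c j)"
    by (simp add: vanishes_on_iff)
  show "vanishes_on (cyc j) (chart_dom c) (insert_covectors c p (I c j))"
    by (rule formally_zero_identity_holds[OF _ zero]) (rule finite_support)
qed

end
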